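(* Every locally testable group has finitely many conjugacy classes of torsion elements.
   Context: A generating set $X$ of a group $G$ is symmetric if it is closed under taking inverses. For a finite symmetric generating set $X$ of $G$, $\mathrm{Geo}(G,X)\subseteq X^*$ denotes the set of all words over $X$ that label geodesic paths in the Cayley graph of $G$ with respect to $X$, i.e. the words $w$ such that no strictly shorter word over $X$ represents the same element of $G$ as $w$. For a finite set $X$, a natural number $k>0$ and $u\in X^*$ of length $l(u)\ge k$, let $\mathrm{pre}_k(u)$ and $\mathrm{suf}_k(u)$ be the prefix and suffix of $u$ of length $k$, and $\mathrm{sub}_k(u)$ the set of all contiguous subwords of $u$ of length $k$; if $l(u)<k$ put $\mathrm{pre}_k(u)=\mathrm{suf}_k(u)=u$ and $\mathrm{sub}_k(u)=\emptyset$; $\mathrm{pre}_0(u)$ and $\mathrm{suf}_0(u)$ are the empty word. Write $u\sim_k v$ if $\mathrm{pre}_{k-1}(u)=\mathrm{pre}_{k-1}(v)$, $\mathrm{suf}_{k-1}(u)=\mathrm{suf}_{k-1}(v)$ and $\mathrm{sub}_k(u)=\mathrm{sub}_k(v)$. A language $L\subseteq X^*$ is $k$-locally testable if it is a union of equivalence classes of $\sim_k$. A group $G$ is $k$-locally testable if $\mathrm{Geo}(G,X)$ is $k$-locally testable for some finite symmetric generating set $X$ of $G$, and $G$ is locally testable if it is $k$-locally testable for some $k>0$. *)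

theory Defs
  imports "HOL-Algebra.Generated_Groups" "HOL-Algebra.Group_Action" "HOL-Library.Sublist"
begin

section \<open>Geodesic words\<close>

definition symmetric_generating_set :: "('a, 'b) monoid_scheme \<Rightarrow> 'a set \<Rightarrow> bool" where
  "symmetric_generating_set G X \<longleftrightarrow>
     X \<subseteq> carrier G \<and> (\<forall>x\<in>X. inv\<^bsub>G\<^esub> x \<in> X) \<and> generate G X = carrier G"

definition word_value :: "('a, 'b) monoid_scheme \<Rightarrow> 'a list \<Rightarrow> 'a" where
  "word_value G w = foldr (\<otimes>\<^bsub>G\<^esub>) w \<one>\<^bsub>G\<^esub>"

definition Geo :: "('a, 'b) monoid_scheme \<Rightarrow> 'a set \<Rightarrow> 'a list set" where
  "Geo G X = {w \<in> lists X.
     \<not> (\<exists>v \<in> lists X. length v < length w \<and> word_value G v = word_value G w)}"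

section \<open>Locally testable languages and groups\<close>

text \<open>
  Truncated subtraction in \<open>suf_word\<close> makes prefix and suffix equal to the whole word
  if its length is less than \<open>k\<close>; in that case \<open>sub_words\<close> is empty.
\<close>

definition pre_word :: "nat \<Rightarrow> 'a list \<Rightarrow> 'a list" where
  "pre_word k u = take k u"

definition suf_word :: "nat \<Rightarrow> 'a list \<Rightarrow> 'a list" where
  "suf_word k u = drop (length u - k) u"

definition sub_words :: "nat \<Rightarrow> 'a list \<Rightarrow> 'a list set" where
  "sub_words k u = {v. sublist v u \<and> length v = k}"

text \<open>Only used for \<open>k > 0\<close>, so that \<open>k - 1\<close> is not truncated.\<close>

definition sim_rel :: "'a set \<Rightarrow> nat \<Rightarrow> ('a list \<times> 'a list) set" where
  "sim_rel X k = {(u, v). u \<in> lists X \<and> v \<in> lists X \<and>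
     pre_word (k - 1) u = pre_word (k - 1) v \<and>
     suf_word (k - 1) u = suf_word (k - 1) v \<and>
     sub_words k u = sub_words k v}"

lemma equiv_sim_rel: "equiv (lists X) (sim_rel X k)"
  by (rule equivI) (auto simp: sim_rel_def refl_on_def sym_def trans_def)

definition k_locally_testable_language :: "'a set \<Rightarrow> nat \<Rightarrow> 'a list set \<Rightarrow> bool" where
  "k_locally_testable_language X k L \<longleftrightarrow> (\<exists>C \<subseteq> lists X // sim_rel X k. L = \<Union>C)"

definition k_locally_testable_group :: "nat \<Rightarrow> ('a, 'b) monoid_scheme \<Rightarrow> bool" where
  "k_locally_testable_group k G \<longleftrightarrow>
     (\<exists>X. finite X \<and> symmetric_generating_set G X \<and> k_locally_testable_language X k (Geo G X))"

definition locally_testable_group :: "('a, 'b) monoid_scheme \<Rightarrow> bool" where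
  "locally_testable_group G \<longleftrightarrow> (\<exists>k>0. k_locally_testable_group k G)"

section \<open>Conjugacy classes of torsion elements\<close>

definition torsion_elements :: "('a, 'b) monoid_scheme \<Rightarrow> 'a set" where
  "torsion_elements G = {x \<in> carrier G. \<exists>n::nat. n > 0 \<and> x [^]\<^bsub>G\<^esub> n = \<one>\<^bsub>G\<^esub>}"

text \<open>The action from \<open>group.action_by_conjugation\<close>; its orbits are the conjugacy classes.\<close>

definition conjugation :: "('a, 'b) monoid_scheme \<Rightarrow> 'a \<Rightarrow> 'a \<Rightarrow> 'a" where
  "conjugation G = (\<lambda>g. \<lambda>h \<in> carrier G. g \<otimes>\<^bsub>G\<^esub> h \<otimes>\<^bsub>G\<^esub> inv\<^bsub>G\<^esub> g)"

end

theory Submission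
  imports Defs
begin

text \<open>
  Let \<open>Geo(G,X)\<close> be \<open>k\<close>-locally testable, and let \<open>w\<close> be a word of least length among all words
  representing a conjugate of a given torsion element. Every cyclic rotation of \<open>w\<close> represents
  a conjugate of the same element, so it is geodesic too, by minimality.

  If \<open>w\<close> is long in terms of \<open>k\<close> and the size of \<open>X\<close>, then by the pigeonhole principle some word
  \<open>s\<close> of length \<open>2k\<close> occurs in \<open>w\<close> at two disjoint places. Write \<open>s = p q\<close> with both halves of
  length \<open>k\<close>, and rotate \<open>w\<close> so that it is cut in the middle of one of these occurrences. The
  rotation \<open>u\<close> then begins with \<open>q\<close>, ends with \<open>p\<close>, and still contains \<open>p q\<close>. A subword of length
  \<open>k\<close> of a power of \<open>u\<close> that straddles two copies of \<open>u\<close> lies inside \<open>p q\<close>, hence occurs in \<open>u\<close>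
  already. So all positive powers of \<open>u\<close> are \<open>\<sim>\<^sub>k\<close>-equivalent to \<open>u\<close>, and by local testability all
  of them are geodesic (\<open>power_sim_rel\<close>). This is impossible, since some positive power of \<open>u\<close>
  represents the identity, which the shorter empty word represents as well.

  Hence each conjugacy class of torsion elements has a representative word of bounded length, and
  there are only finitely many words of bounded length over a finite alphabet.
\<close>

section \<open>Words and local testability\<close>

lemma sublist_append_cases:
  assumes "sublist v (a @ b)"
  obtains "sublist v a" | "sublist v b"
    | v1 v2 where "v = v1 @ v2" "suffix v1 a" "prefix v2 b"
  using assms by (auto simp: sublist_append)

text \<open>
  A straddling subword of length \<open>k\<close> reaches at most \<open>k\<close> letters to either side of the junction,
  so it depends only on the \<open>k\<close> letters before and after it.
\<close>

lemma sub_words_append_subset: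
  assumes "k \<le> length p" "k \<le> length q"
  shows "sub_words k ((y @ p) @ (q @ x))
    \<subseteq> sub_words k (y @ p) \<union> sub_words k (q @ x) \<union> sub_words k (p @ q)"
proof
  fix v assume "v \<in> sub_words k ((y @ p) @ (q @ x))"
  then have v: "sublist v ((y @ p) @ (q @ x))" "length v = k"
    by (auto simp: sub_words_def)
  from v(1) show "v \<in> sub_words k (y @ p) \<union> sub_words k (q @ x) \<union> sub_words k (p @ q)"
  proof (cases rule: sublist_append_cases)
    case (3 v1 v2)
    have "suffix v1 p"
      by (rule suffix_length_suffix[OF 3(2) suffixI[OF refl]]) (use 3(1) v(2) assms(1) in simp)
    moreover have "prefix v2 q"
      by (rule prefix_length_prefix[OF 3(3) prefixI[OF refl]]) (use 3(1) v(2) assms(2) in simp)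
    ultimately have "sublist v (p @ q)"
      using 3(1) by (auto simp: sublist_append)
    then show ?thesis using v(2) by (auto simp: sub_words_def)
  qed (use v(2) in \<open>auto simp: sub_words_def\<close>)
qed

lemma sub_words_mono: "sublist u v \<Longrightarrow> sub_words k u \<subseteq> sub_words k v"
  by (auto simp: sub_words_def intro: sublist_order.order_trans)

text \<open>
  If the word \<open>p q\<close> around the junction of two copies of \<open>u\<close> already occurs in \<open>u\<close>, then \<open>\<sim>\<^sub>k\<close>
  cannot distinguish \<open>u\<close> from its positive powers.
\<close>

lemma power_sim_rel:
  assumes u: "u \<in> lists X" "u = q @ x" "u = y @ p"
    and pq: "sublist (p @ q) u" "k \<le> length p" "k \<le> length q"
  shows "(u, concat (replicate (Suc m) u)) \<in> sim_rel X k"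
proof -
  let ?P = "\<lambda>m. concat (replicate m u)"
  have len: "k \<le> length u" using u(2) pq(3) by simp
  have in_lists: "?P m \<in> lists X" for m
    using u(1) by auto
  have suffix_power: "\<exists>z. ?P (Suc m) = z @ u" for m
    by (induction m) auto
  have subs: "sub_words k (?P (Suc m)) = sub_words k u" for m
  proof (induction m)
    case (Suc m)
    have eqs: "y @ p = u" "q @ (x @ ?P m) = ?P (Suc m)"
      using u(2,3) by simp_all
    have "sub_words k (?P (Suc (Suc m))) \<subseteq>
        sub_words k u \<union> sub_words k (?P (Suc m)) \<union> sub_words k (p @ q)"
      using sub_words_append_subset[OF pq(2,3), of y "x @ ?P m"] unfolding eqs by simp
    also have "\<dots> \<subseteq> sub_words k u"
      using Suc.IH sub_words_mono[OF pq(1)] by blast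
    finally have "sub_words k (?P (Suc (Suc m))) \<subseteq> sub_words k u" .
    moreover have "sub_words k u \<subseteq> sub_words k (?P (Suc (Suc m)))"
      by (intro sub_words_mono) auto
    ultimately show ?case by blast
  qed simp
  obtain z where z: "?P (Suc m) = z @ u" using suffix_power by blast
  have "pre_word (k - 1) u = pre_word (k - 1) (?P (Suc m))"
    using len by (simp add: pre_word_def)
  moreover have "suf_word (k - 1) u = suf_word (k - 1) (?P (Suc m))"
    unfolding z using len by (simp add: suf_word_def)
  moreover note subs[of m, symmetric] in_lists[of "Suc m"] u(1)
  ultimately show ?thesis by (simp add: sim_rel_def)
qed

lemma k_locally_testable_language_closed:
  assumes "k_locally_testable_language X k L" "(u, v) \<in> sim_rel X k" "u \<in> L"
  shows "v \<in> L"
proof -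
  obtain C where C: "C \<subseteq> lists X // sim_rel X k" "L = \<Union>C"
    using assms(1) by (auto simp: k_locally_testable_language_def)
  then obtain c where c: "c \<in> C" "u \<in> c" using assms(3) by blast
  have "v \<in> c"
    using in_quotient_imp_closed[OF equiv_sim_rel _ c(2) assms(2)] C(1) c(1) by blast
  with c(1) C(2) show ?thesis by blast
qed

text \<open>
  Cut \<open>w\<close> into consecutive blocks of length \<open>l\<close>; there are more blocks than words of length \<open>l\<close>.
\<close>

lemma repeated_block:
  assumes "finite X" "set w \<subseteq> X" "l * Suc (card X ^ l) \<le> length w"
  obtains a s b c where "w = a @ s @ b @ s @ c" "length s = l"
proof -
  define N where "N = card X ^ l"
  let ?f = "\<lambda>i. take l (drop (i * l) w)"
  let ?B = "{s. set s \<subseteq> X \<and> length s = l}"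
  have fits: "i * l + l \<le> length w" if "i \<le> N" for i
  proof -
    have "i * l + l = l * Suc i" by simp
    also have "\<dots> \<le> l * Suc N" using that by (intro mult_le_mono2) simp
    finally show ?thesis using assms(3) unfolding N_def by (rule le_trans)
  qed
  have "?f ` {..N} \<subseteq> ?B"
    using fits assms(2) by (fastforce dest: in_set_takeD in_set_dropD)
  moreover have "card ?B < card {..N}" "finite ?B"
    using card_lists_length_eq[OF assms(1)] finite_lists_length_eq[OF assms(1)]
    by (auto simp: N_def)
  ultimately have "\<not> inj_on ?f {..N}"
    by (meson card_inj_on_le linorder_not_le)
  then obtain i j where ij: "i < j" "j \<le> N" "?f i = ?f j"
    unfolding inj_on_def by (metis atMost_iff linorder_neqE_nat)
  have split: "v = take m v @ take l (drop m v) @ drop (m + l) v" for m and v :: "'a list"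
  proof -
    have "take l (drop m v) @ drop (m + l) v = drop m v"
      using append_take_drop_id[of l "drop m v"] by (simp add: add.commute)
    then show ?thesis by simp
  qed
  have le: "i * l + l \<le> j * l"
    using mult_le_mono1[of "Suc i" j l] ij(1) by simp
  define b where "b = drop (i * l + l) (take (j * l) w)"
  have "take (i * l) (take (j * l) w) = take (i * l) w"
    using add_leD1[OF le] by (simp only: take_take min.absorb1)
  moreover have "take l (drop (i * l) (take (j * l) w)) = ?f i"
    using le by (simp add: drop_take min_def)
  ultimately have "take (j * l) w = take (i * l) w @ ?f i @ b"
    using split[of "take (j * l) w" "i * l"] by (simp add: b_def)
  then have "w = take (i * l) w @ ?f i @ b @ ?f i @ drop (j * l + l) w"
    using split[of w "j * l"] ij(3) by (metis append.assoc)
  moreover have "length (?f i) = l"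
    using fits[of i] ij(1,2) by simp
  ultimately show thesis by (rule that)
qed

section \<open>Values of words\<close>

context group
begin

lemma word_value_closed: "set w \<subseteq> carrier G \<Longrightarrow> word_value G w \<in> carrier G"
  by (induction w) (auto simp: word_value_def)

lemma word_value_append:
  "set u \<subseteq> carrier G \<Longrightarrow> set v \<subseteq> carrier G \<Longrightarrow>
    word_value G (u @ v) = word_value G u \<otimes> word_value G v"
proof (induction u)
  case Nil
  then show ?case using word_value_closed[of v] by (simp add: word_value_def)
next
  case (Cons a u)
  then show ?case
    using word_value_closed[of v] word_value_closed[of u]
    by (simp add: word_value_def m_assoc)
qed

lemma word_value_power:
  assumes "set u \<subseteq> carrier G"
  shows "word_value G (concat (replicate m u)) = word_value G u [^] m"
proof (induction m)
  case (Suc m)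
  have "set (concat (replicate m u)) \<subseteq> carrier G" using assms by auto
  then show ?case
    using Suc assms nat_pow_Suc2[OF word_value_closed[OF assms], of m]
    by (simp add: word_value_append)
qed (simp add: word_value_def)

lemma generate_word:
  assumes "symmetric_generating_set G X" "g \<in> carrier G"
  obtains w where "set w \<subseteq> X" "word_value G w = g"
proof -
  have X: "X \<subseteq> carrier G" "\<And>x. x \<in> X \<Longrightarrow> inv x \<in> X" and "g \<in> generate G X"
    using assms by (auto simp: symmetric_generating_set_def)
  from this(3) have "\<exists>w. set w \<subseteq> X \<and> word_value G w = g"
  proof induction
    case one
    then show ?case by (intro exI[of _ "[]"]) (simp add: word_value_def)
  next
    case (incl h)
    then show ?case using X by (intro exI[of _ "[h]"]) (auto simp: word_value_def)
  next
    case (inv h)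
    then show ?case using X by (intro exI[of _ "[inv h]"]) (auto simp: word_value_def)
  next
    case (eng h1 h2)
    then obtain w1 w2 where "set w1 \<subseteq> X" "word_value G w1 = h1" "set w2 \<subseteq> X" "word_value G w2 = h2"
      by blast
    then show ?case using X by (intro exI[of _ "w1 @ w2"]) (auto simp: word_value_append)
  qed
  then show thesis using that by blast
qed

section \<open>Conjugacy\<close>

lemma conjugation_action: "group_action G (carrier G) (conjugation G)"
  unfolding conjugation_def by (rule action_by_conjugation)

lemma orbit_conjugation_iff:
  "x \<in> carrier G \<Longrightarrow>
    y \<in> orbit G (conjugation G) x \<longleftrightarrow> (\<exists>g\<in>carrier G. y = g \<otimes> x \<otimes> inv g)"
  by (auto simp: orbit_def conjugation_def)

lemma orbit_conjugation_eq:
  assumes "x \<in> carrier G" "y \<in> orbit G (conjugation G) x"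
  shows "orbit G (conjugation G) y = orbit G (conjugation G) x"
proof -
  interpret group_action G "carrier G" "conjugation G" by (rule conjugation_action)
  have closed: "orbit G (conjugation G) a \<subseteq> carrier G" if "a \<in> carrier G" for a
    using that by (auto simp: orbit_def conjugation_def)
  have y: "y \<in> carrier G" using closed assms by blast
  show ?thesis
    using orbit_trans[OF assms(1) y] orbit_trans[OF y assms(1)] orbit_sym[OF assms(1) y assms(2)]
      assms closed y by blast
qed

lemma inv_mult_cancel:
  "g \<in> carrier G \<Longrightarrow> z \<in> carrier G \<Longrightarrow> inv g \<otimes> (g \<otimes> z) = z"
  by (simp flip: m_assoc)

lemma conjugate_pow:
  assumes "g \<in> carrier G" "x \<in> carrier G"
  shows "(g \<otimes> x \<otimes> inv g) [^] (n::nat) = g \<otimes> x [^] n \<otimes> inv g"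
proof (induction n)
  case (Suc n)
  then show ?case
    using assms by (simp add: m_assoc inv_mult_cancel)
qed (use assms in simp)

lemma conjugate_torsion:
  assumes "x \<in> carrier G" "y \<in> orbit G (conjugation G) x" "x [^] (n::nat) = \<one>"
  shows "y [^] n = \<one>"
  using assms conjugate_pow by (auto simp: orbit_conjugation_iff)

lemma rotation_conjugate:
  assumes "set u \<subseteq> carrier G" "set v \<subseteq> carrier G"
  shows "word_value G (v @ u) \<in> orbit G (conjugation G) (word_value G (u @ v))"
proof -
  let ?a = "word_value G u" and ?b = "word_value G v"
  have ab: "?a \<in> carrier G" "?b \<in> carrier G" using assms word_value_closed by auto
  have "?b \<otimes> ?a = inv ?a \<otimes> (?a \<otimes> ?b) \<otimes> inv (inv ?a)"
    using ab by (simp add: inv_mult_cancel)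
  then have "\<exists>g\<in>carrier G. ?b \<otimes> ?a = g \<otimes> (?a \<otimes> ?b) \<otimes> inv g"
    using ab by (intro bexI[of _ "inv ?a"]) auto
  then show ?thesis
    using ab assms by (simp add: orbit_conjugation_iff word_value_append)
qed

section \<open>Short representatives of torsion classes\<close>

lemma torsion_conjugate_short_word:
  assumes X: "finite X" "symmetric_generating_set G X"
    and L: "k_locally_testable_language X k (Geo G X)" "k > 0"
    and x: "x \<in> torsion_elements G"
  obtains w where "set w \<subseteq> X" "length w \<le> (2 * k) * Suc (card X ^ (2 * k))"
    "word_value G w \<in> orbit G (conjugation G) x"
proof -
  let ?O = "orbit G (conjugation G) x"
  have XG: "X \<subseteq> carrier G" using X(2) by (simp add: symmetric_generating_set_def)
  obtain n :: nat where xG: "x \<in> carrier G" and n: "n > 0" "x [^] n = \<one>"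
    using x by (auto simp: torsion_elements_def)
  let ?R = "\<lambda>w. set w \<subseteq> X \<and> word_value G w \<in> ?O"
  have "\<exists>w. ?R w"
    using generate_word[OF X(2) xG] group_action.orbit_refl[OF conjugation_action xG] by metis
  then obtain w where w: "?R w" and min: "\<And>v. ?R v \<Longrightarrow> length w \<le> length v"
    using ex_has_least_nat[of ?R _ length] by blast
  have "length w < (2 * k) * Suc (card X ^ (2 * k))"
  proof (rule ccontr)
    assume "\<not> ?thesis"
    then obtain a s b c where abc: "w = a @ s @ b @ s @ c" "length s = 2 * k"
      using repeated_block[OF X(1), of w "2 * k"] w by (metis not_less)
    define p q where "p = take k s" and "q = drop k s"
    have s: "s = p @ q" and pq: "length p = k" "length q = k"
      using abc(2) by (auto simp: p_def q_def)
    \<comment> \<open>Cut in the middle of the first occurrence of \<open>s\<close>, so that the second one survives.\<close>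
    define u where "u = q @ b @ s @ c @ a @ p"
    have wu: "w = (a @ p) @ (q @ b @ s @ c)" using abc(1) s by simp
    have uX: "set u \<subseteq> X" using w wu by (auto simp: u_def)
    have "set (a @ p) \<subseteq> carrier G" "set (q @ b @ s @ c) \<subseteq> carrier G"
      using w XG unfolding wu by auto
    from rotation_conjugate[OF this]
    have "word_value G u \<in> orbit G (conjugation G) (word_value G w)"
      unfolding wu u_def by simp
    then have uO: "word_value G u \<in> ?O"
      using orbit_conjugation_eq[OF xG] w by blast
    have "length u = length w" using wu by (simp add: u_def)
    then have "length u \<le> length v" if "v \<in> lists X" "word_value G v = word_value G u" for v
      using min[of v] that uO by (simp add: lists_eq_set)
    then have "u \<in> Geo G X"
      using uX by (fastforce simp: Geo_def lists_eq_set)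
    moreover have "(u, concat (replicate (Suc (n - 1)) u)) \<in> sim_rel X k"
    proof (rule power_sim_rel)
      show "u = q @ (b @ s @ c @ a @ p)" "u = (q @ b @ s @ c @ a) @ p" by (simp_all add: u_def)
      have "u = (q @ b) @ (p @ q) @ (c @ a @ p)" by (simp add: u_def s)
      then show "sublist (p @ q) u" by (metis sublist_appendI)
    qed (use uX pq in auto)
    ultimately have geo: "concat (replicate n u) \<in> Geo G X"
      using k_locally_testable_language_closed[OF L(1)] n(1) by fastforce
    have "word_value G (concat (replicate n u)) = word_value G []"
      using word_value_power[of u n] conjugate_torsion[OF xG uO n(2)] uX XG
      by (auto simp: word_value_def)
    moreover have "length [] < length (concat (replicate n u))"
      using n(1) pq(1) L(2) by (auto simp: u_def)
    ultimately show False
      using geo by (force simp: Geo_def)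
  qed
  with w show thesis by (intro that[of w]) auto
qed

end

theorem theorem5p1:
  fixes G :: "('a, 'b) monoid_scheme"
  assumes "group G"
    and "locally_testable_group G"
  shows "finite (orbits G (torsion_elements G) (conjugation G))"
proof -
  interpret group G by (rule assms(1))
  obtain k X where k: "k > 0" and X: "finite X" "symmetric_generating_set G X"
    and L: "k_locally_testable_language X k (Geo G X)"
    using assms(2) by (auto simp: locally_testable_group_def k_locally_testable_group_def)
  let ?W = "{w. set w \<subseteq> X \<and> length w \<le> (2 * k) * Suc (card X ^ (2 * k))}"
  have "orbits G (torsion_elements G) (conjugation G)
      \<subseteq> (\<lambda>w. orbit G (conjugation G) (word_value G w)) ` ?W"
  proof
    fix C assume "C \<in> orbits G (torsion_elements G) (conjugation G)"
    then obtain x where x: "x \<in> torsion_elements G" and C: "C = orbit G (conjugation G) x"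
      by (auto simp: orbits_def)
    have xG: "x \<in> carrier G" using x by (simp add: torsion_elements_def)
    obtain w where w: "set w \<subseteq> X" "length w \<le> (2 * k) * Suc (card X ^ (2 * k))"
      "word_value G w \<in> orbit G (conjugation G) x"
      by (rule torsion_conjugate_short_word[OF X L k x])
    have "C = orbit G (conjugation G) (word_value G w)"
      using orbit_conjugation_eq[OF xG w(3)] C by simp
    then show "C \<in> (\<lambda>w. orbit G (conjugation G) (word_value G w)) ` ?W"
      by (rule image_eqI) (intro CollectI conjI w(1,2))
  qed
  then show ?thesis
    by (rule finite_subset) (intro finite_imageI finite_lists_length_le X(1))
qed

end
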